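(* Suppose that the abc conjecture holds. Fix a positive integer $\alpha$ and a positive constant $c_0$. Then there is a constant $c_1$ (depending only on $\alpha$ and $c_0$) such that the following holds. Let $h_0,\dots,h_{k-1}$ be any non-constant arithmetic progression in $G_\alpha$, with $h_i=\eta_i x_i^{l_i}$ $(0\le i\le k-1)$, such that $\gcd(h_0,h_1)\le c_0$. Then $\max(k,l)<c_1$, where $l=\max_{0\le i\le k-1} l_i$. Moreover, the number of such progressions with $l_i\ge 4$ (for all $i$) is bounded.
   Context: For a non-zero integer $y$, $N(y)=\prod_{p\mid y}p$ (product over the distinct primes dividing $y$; $N(\pm1)=1$). abc conjecture: for every $\epsilon>0$ there is a constant $K(\epsilon)$ depending only on $\epsilon$ such that whenever $a,b,c$ are three coprime non-zero integers with $a+b=c$, one has $c<K(\epsilon)N(abc)^{1+\epsilon}$. For a positive integer $\alpha$, $G_\alpha=\{\eta x^l \mid \eta,x,l\in\mathbb{Z},\ \eta\neq 0,\ x>0,\ l\ge 2,\ N(\eta)\le\alpha\}$. An arithmetic progression in $G_\alpha$ with $h_i=\eta_i x_i^{l_i}$ means that each term is written in the form appearing in the definition of $G_\alpha$ (so $\eta_i\ne0$, $x_i>0$, $l_i\ge2$, $N(\eta_i)\le\alpha$), where moreover $\eta_i$ is assumed to be $l_i$-th power free.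
   Formalization: Here l is the maximum of l_i over terms with x_i ≠ 1; the bound on l is claimed for k ≥ 4, and for k = 3 when at most one l_i equals 2 (k is bounded always); the finiteness claim for l_i ≥ 4 is for k ≥ 3. The excluded cases fail, e.g. 1, 2^l or a², 5^l, b². *)

theory Defs
  imports Complex_Main "HOL-Computational_Algebra.Primes"
begin

definition rad :: "int \<Rightarrow> int" where
  "rad y = \<Prod>(prime_factors y)"

definition abc_conjecture :: bool where
  "abc_conjecture \<longleftrightarrow>
     (\<forall>\<epsilon>::real. \<epsilon> > 0 \<longrightarrow>
       (\<exists>K::real. \<forall>a b c::int. a \<noteq> 0 \<and> b \<noteq> 0 \<and> c \<noteq> 0 \<and> Gcd {a, b, c} = 1 \<and> a + b = c \<longrightarrow>
          real_of_int c < K * real_of_int (rad (a * b * c)) powr (1 + \<epsilon>)))"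

definition is_rep :: "nat \<Rightarrow> int \<Rightarrow> int \<Rightarrow> int \<Rightarrow> nat \<Rightarrow> bool" where
  "is_rep \<alpha> h \<eta> x l \<longleftrightarrow>
     h = \<eta> * x ^ l \<and> \<eta> \<noteq> 0 \<and> x > 0 \<and> l \<ge> 2 \<and> rad \<eta> \<le> int \<alpha>"

definition G :: "nat \<Rightarrow> int set" where
  "G \<alpha> = {h. \<exists>\<eta> x l. is_rep \<alpha> h \<eta> x l}"

definition power_free :: "nat \<Rightarrow> int \<Rightarrow> bool" where
  "power_free l \<eta> \<longleftrightarrow> (\<forall>d. d ^ l dvd \<eta> \<longrightarrow> is_unit d)"

definition arith_prog :: "int list \<Rightarrow> bool" where
  "arith_prog h \<longleftrightarrow> (\<exists>a d. \<forall>i < length h. h ! i = a + int i * d)"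

definition nonconstant :: "int list \<Rightarrow> bool" where
  "nonconstant h \<longleftrightarrow> (\<exists>i < length h. \<exists>j < length h. h ! i \<noteq> h ! j)"

text \<open>A nonconstant progression has at least two terms, so \<open>h ! 0\<close> and \<open>h ! 1\<close> below are
  genuine terms. The values of \<open>\<eta>\<close>, \<open>x\<close>, \<open>l\<close> outside the index range are irrelevant.\<close>

definition represented_prog ::
  "nat \<Rightarrow> real \<Rightarrow> int list \<Rightarrow> (nat \<Rightarrow> int) \<Rightarrow> (nat \<Rightarrow> int) \<Rightarrow> (nat \<Rightarrow> nat) \<Rightarrow> bool" where
  "represented_prog \<alpha> c\<^sub>0 h \<eta> x l \<longleftrightarrow>
     arith_prog h \<and> nonconstant h \<and> set h \<subseteq> G \<alpha> \<and>
     (\<forall>i < length h. is_rep \<alpha> (h ! i) (\<eta> i) (x i) (l i) \<and> power_free (l i) (\<eta> i)) \<and>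
     real_of_int (gcd (h ! 0) (h ! 1)) \<le> c\<^sub>0"

text \<open>The exponent of a term with \<open>x i = 1\<close> is not determined by the term (\<open>1 ^ l = 1\<close> for
  every \<open>l\<close>), so such terms do not contribute to the maximal exponent.\<close>

definition max_exponent :: "nat \<Rightarrow> (nat \<Rightarrow> int) \<Rightarrow> (nat \<Rightarrow> nat) \<Rightarrow> nat" where
  "max_exponent k x l = Max (insert 0 (l ` {i. i < k \<and> x i \<noteq> 1}))"

text \<open>The lengths and exponents for which the exponents can be bounded at all. Two-term
  progressions such as \<open>1, 2 ^ l\<close> are excluded, and so are three-term progressions two of whose
  terms have exponent 2: with \<open>a + b \<i> = (1 + \<i>) (2 + \<i>) ^ l\<close> one has
  \<open>a\<^sup>2 + b\<^sup>2 = 2 * 5 ^ l\<close>, so \<open>a\<^sup>2, 5 ^ l, b\<^sup>2\<close> is a progression of pairwise coprime powers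
  with \<open>l\<close> arbitrarily large.\<close>

definition nondegenerate :: "nat \<Rightarrow> (nat \<Rightarrow> nat) \<Rightarrow> bool" where
  "nondegenerate k l \<longleftrightarrow> k \<ge> 3 \<and> (k = 3 \<longrightarrow> card {i. i < k \<and> l i = 2} \<le> 1)"

end

theory Submission
  imports Defs
begin

text \<open>
  A term \<open>h = \<eta> * x ^ l\<close> with \<open>rad \<eta> \<le> \<alpha>\<close> has radical at most \<open>\<alpha> * \<bar>h\<bar> powr (1 / l)\<close>
  (\<open>rad_le_root\<close>). Hence an equation \<open>A + B = C\<close> whose members are built from terms of the
  progression has a small radical compared with its size, and the abc conjecture bounds the terms
  (\<open>abc_height_bound\<close>). Two equations are enough.

  For three terms it is \<open>a + (a + 2 * d) = 2 * (a + d)\<close>. It bounds the terms as long as the sum of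
  the reciprocals of the three exponents stays below a fixed number less than 1
  (\<open>three_powers_bounded\<close>).

  When the exponents can all be 2, an equation of higher degree is necessary, in which many terms
  occur at once. The identity \<open>sextic_identity\<close> has degree 6 and its radical divides
  twice the product of \<open>d\<close>, a quadratic form and the five terms
  \<open>t - 2 * d, t - d, t, t + d, t + 2 * d\<close>. With exponents at least 2 the radical has
  order at most \<open>1 + 2 + 5 / 2 < 6\<close>. So the terms of any five-term progression are bounded
  (\<open>five_powers_bounded\<close>), and, by sliding a window of five terms, so are those of every longer
  progression; as they are distinct integers, the length is bounded. For four terms there is room
  for one arbitrary fifth term as soon as one exponent is at least 3 (\<open>four_powers_bounded\<close>).

  A bound on a term bounds its exponent, unless \<open>x = 1\<close>, because \<open>x \<ge> 2\<close> gives
  \<open>l < 2 ^ l \<le> \<bar>h\<bar>\<close>. For three terms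
  of which at most one has exponent 2, an exponent that is at least 7 makes the sum of reciprocals
  at most \<open>1 / 2 + 1 / 3 + 1 / 7 = 41 / 42\<close>, so exponents are bounded there too. If
  all exponents are at least 4, that sum is at most \<open>3 / 4\<close> for any three consecutive terms; then all
  terms and the length are bounded, and only finitely many progressions remain.\<close>

section \<open>The radical\<close>

lemma prime_factor_ge_1: "p \<in> prime_factors y \<Longrightarrow> 1 \<le> p" for y :: int
  using prime_ge_1_int by (simp add: in_prime_factors_iff)

lemma rad_ge_1: "1 \<le> rad y"
  unfolding rad_def by (rule prod_ge_1) (rule prime_factor_ge_1)

lemma rad_minus [simp]: "rad (- y) = rad y"
proof -
  have "prime_factorization (- y) = prime_factorization y"
    by (rule prime_factorization_cong) simp
  then show ?thesis
    by (simp add: rad_def)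
qed

lemma rad_power:
  assumes "n > 0"
  shows "rad (y ^ n) = rad y"
proof (cases "y = 0")
  case False
  then have "prime_factors (y ^ n) = prime_factors y"
    using assms by (auto simp: prime_factors_dvd prime_dvd_power_iff)
  then show ?thesis
    by (simp add: rad_def)
qed (use assms in \<open>simp add: zero_power\<close>)

lemma rad_le_abs:
  assumes "y \<noteq> 0"
  shows "rad y \<le> \<bar>y\<bar>"
proof -
  have "rad y \<le> (\<Prod>p\<in>prime_factors y. p ^ multiplicity p y)"
    unfolding rad_def
  proof (rule prod_mono, safe)
    fix p assume p: "p \<in> prime_factors y"
    show "0 \<le> p"
      using prime_factor_ge_1[OF p] by simp
    show "p \<le> p ^ multiplicity p y"
      using p prime_factor_ge_1[OF p] by (intro self_le_power) (auto simp: prime_factors_multiplicity)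
  qed
  also have "\<dots> = \<bar>y\<bar>"
    using prod_prime_factors[OF assms] by simp
  finally show ?thesis .
qed

lemma rad_mult_le:
  assumes "x \<noteq> 0" "y \<noteq> 0"
  shows "rad (x * y) \<le> rad x * rad y"
proof -
  let ?X = "prime_factors x" and ?Y = "prime_factors y"
  have ge: "1 \<le> \<Prod>(?X \<inter> ?Y)"
    by (rule prod_ge_1) (auto intro: prime_factor_ge_1)
  have ge': "0 \<le> \<Prod>(?X \<union> ?Y)"
    using prime_factor_ge_1 by (intro prod_nonneg) force
  have "rad (x * y) = \<Prod>(?X \<union> ?Y)"
    using prime_factors_product[OF assms] by (simp add: rad_def)
  also have "\<dots> \<le> \<Prod>(?X \<union> ?Y) * \<Prod>(?X \<inter> ?Y)"
    using mult_left_mono[OF ge ge'] by simp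
  also have "\<dots> = rad x * rad y"
    unfolding rad_def by (rule prod.union_inter) simp_all
  finally show ?thesis .
qed

lemma rad_mono_dvd:
  assumes "x dvd y" "y \<noteq> 0"
  shows "rad x \<le> rad y"
  unfolding rad_def
proof (rule prod_mono2)
  show "prime_factors x \<subseteq> prime_factors y"
    using assms by (simp add: dvd_prime_factors)
  show "0 \<le> p" if "p \<in> prime_factors x" for p
    using prime_factor_ge_1[OF that] by simp
qed (auto intro: prime_factor_ge_1)

lemma rad_2 [simp]: "rad 2 = 2"
  by (simp add: rad_def prime_factorization_prime)

text \<open>The mechanism behind all radical bounds: the factor \<open>\<eta>\<close> contributes at most \<open>\<alpha>\<close>, and the
  power \<open>x ^ l\<close> contributes at most \<open>x\<close>, which is at most the \<open>l\<close>-th root of the term.\<close>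

lemma rad_le_root:
  assumes rep: "is_rep \<alpha> h \<eta> x l" and le: "real_of_int \<bar>h\<bar> \<le> H"
  shows "real_of_int (rad h) \<le> real \<alpha> * H powr (1 / real l)"
proof -
  from rep have h: "h = \<eta> * x ^ l" "\<eta> \<noteq> 0" "x > 0" "l \<ge> 2" and \<eta>: "rad \<eta> \<le> int \<alpha>"
    by (auto simp: is_rep_def)
  have "rad h \<le> rad \<eta> * rad x"
    using rad_mult_le[of \<eta> "x ^ l"] h by (simp add: rad_power)
  also have "\<dots> \<le> int \<alpha> * x"
    using \<eta> rad_le_abs[of x] rad_ge_1[of x] h by (intro mult_mono) auto
  finally have rad: "real_of_int (rad h) \<le> real \<alpha> * real_of_int x"
    by (metis of_int_le_iff of_int_mult of_int_of_nat_eq)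
  have "1 * x ^ l \<le> \<bar>\<eta>\<bar> * x ^ l"
    using h by (intro mult_right_mono) auto
  then have "x ^ l \<le> \<bar>h\<bar>"
    using h by (simp add: abs_mult)
  then have "real_of_int x ^ l \<le> H"
    using le by (metis of_int_le_iff of_int_power order_trans)
  then have "(real_of_int x ^ l) powr (1 / real l) \<le> H powr (1 / real l)"
    using h by (intro powr_mono2) auto
  then have "real_of_int x \<le> H powr (1 / real l)"
    using h by (simp add: powr_powr flip: powr_realpow)
  then show ?thesis
    using rad by (meson mult_left_mono of_nat_0_le_iff order_trans)
qed

lemma exponent_less_abs:
  assumes "is_rep \<alpha> h \<eta> x l" "x \<noteq> 1"
  shows "int l < \<bar>h\<bar>"
proof -
  from assms have h: "h = \<eta> * x ^ l" "\<eta> \<noteq> 0" "x \<ge> 2"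
    by (auto simp: is_rep_def)
  have "int l < 2 ^ l"
    by simp
  also have "\<dots> \<le> x ^ l"
    using h by (intro power_mono) auto
  also have "\<dots> \<le> \<bar>\<eta>\<bar> * x ^ l"
    using h by simp
  also have "\<dots> = \<bar>h\<bar>"
    using h by (simp add: abs_mult)
  finally show ?thesis .
qed

section \<open>The abc conjecture as a height bound\<close>

text \<open>Dividing by a common divisor of size at most \<open>g\<close> costs only a constant factor, and applying the
  conjecture to the negated triple as well turns the bound on \<open>c\<close> into one on \<open>\<bar>c\<bar>\<close>.\<close>

lemma abc_abs_bound:
  assumes abc: abc_conjecture and "\<epsilon> > 0" "g \<ge> 0"
  obtains K :: real where "K > 0"
    "\<And>A B C :: int. A \<noteq> 0 \<Longrightarrow> B \<noteq> 0 \<Longrightarrow> C \<noteq> 0 \<Longrightarrow> A + B = C \<Longrightarrow> real_of_int (Gcd {A, B, C}) \<le> g \<Longrightarrow>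
       real_of_int \<bar>C\<bar> \<le> K * real_of_int (rad (A * B * C)) powr (1 + \<epsilon>)"
proof -
  obtain K0 :: real where "\<forall>a b c :: int. a \<noteq> 0 \<and> b \<noteq> 0 \<and> c \<noteq> 0 \<and> Gcd {a, b, c} = 1 \<and> a + b = c \<longrightarrow>
       real_of_int c < K0 * real_of_int (rad (a * b * c)) powr (1 + \<epsilon>)"
    using abc[unfolded abc_conjecture_def, rule_format, OF \<open>\<epsilon> > 0\<close>] ..
  then have K0: "real_of_int c < K0 * real_of_int (rad (a * b * c)) powr (1 + \<epsilon>)"
    if "a \<noteq> 0" "b \<noteq> 0" "c \<noteq> 0" "Gcd {a, b, c} = 1" "a + b = c" for a b c :: int
    using that by (simp only: simp_thms)
  define K where "K = (g + 1) * (\<bar>K0\<bar> + 1)"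
  show ?thesis
  proof (rule that)
    show "K > 0"
      using \<open>g \<ge> 0\<close> by (simp add: K_def add_pos_nonneg)
    fix A B C :: int
    assume nz: "A \<noteq> 0" "B \<noteq> 0" "C \<noteq> 0" and sum: "A + B = C"
      and gcd: "real_of_int (Gcd {A, B, C}) \<le> g"
    define G where "G = Gcd {A, B, C}"
    have G: "G > 0"
      using nz by (simp add: G_def)
    have dvd: "G dvd A" "G dvd B" "G dvd C"
      unfolding G_def by (rule Gcd_dvd; simp)+
    obtain a where a: "A = G * a"
      using dvd(1) ..
    obtain b where b: "B = G * b"
      using dvd(2) ..
    obtain c where c: "C = G * c"
      using dvd(3) ..
    note abc = a b c
    have nz': "a \<noteq> 0" "b \<noteq> 0" "c \<noteq> 0"
      using nz abc by auto
    have "G * (a + b) = G * c"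
      using sum unfolding abc by (simp only: distrib_left)
    then have sum': "a + b = c"
      using G by simp
    have scaled: "(*) G ` {a, b, c} = {A, B, C}"
      by (simp only: abc image_insert image_empty)
    have "G = Gcd ((*) G ` {a, b, c})"
      unfolding scaled by (rule G_def)
    also have "\<dots> = G * Gcd {a, b, c}"
      unfolding Gcd_mult using G by (simp add: normalize_mult)
    finally have coprime: "Gcd {a, b, c} = 1"
      using G by simp
    let ?r = "real_of_int (rad (a * b * c)) powr (1 + \<epsilon>)"
    have "real_of_int c < K0 * ?r" "real_of_int (- c) < K0 * ?r"
      using K0[of a b c] K0[of "- a" "- b" "- c"] nz' sum' coprime by simp_all
    then have "real_of_int \<bar>c\<bar> \<le> K0 * ?r"
      by linarith
    also have "\<dots> \<le> (\<bar>K0\<bar> + 1) * ?r"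
      by (intro mult_right_mono) auto
    also have "\<dots> \<le> (\<bar>K0\<bar> + 1) * real_of_int (rad (A * B * C)) powr (1 + \<epsilon>)"
    proof (intro mult_left_mono powr_mono2)
      have "a * b * c dvd A * B * C"
        using abc by (intro mult_dvd_mono) auto
      then show "real_of_int (rad (a * b * c)) \<le> real_of_int (rad (A * B * C))"
        using rad_mono_dvd nz by simp
      show "0 \<le> real_of_int (rad (a * b * c))"
        using rad_ge_1[of "a * b * c"] by simp
    qed (use \<open>\<epsilon> > 0\<close> in auto)
    finally have bound: "real_of_int \<bar>c\<bar> \<le> (\<bar>K0\<bar> + 1) * real_of_int (rad (A * B * C)) powr (1 + \<epsilon>)" .
    have "real_of_int \<bar>C\<bar> = real_of_int G * real_of_int \<bar>c\<bar>"
      using abc G by (simp add: abs_mult)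
    also have "\<dots> \<le> (g + 1) * ((\<bar>K0\<bar> + 1) * real_of_int (rad (A * B * C)) powr (1 + \<epsilon>))"
      using gcd bound G \<open>g \<ge> 0\<close> by (intro mult_mono) (auto simp: G_def)
    finally show "real_of_int \<bar>C\<bar> \<le> K * real_of_int (rad (A * B * C)) powr (1 + \<epsilon>)"
      by (simp add: K_def mult.assoc)
  qed
qed

text \<open>The bound holds for each of the three numbers, because \<open>C + (- B) = A\<close> and \<open>C + (- A) = B\<close>
  are again equations of the same form with the same radical.\<close>

lemma abc_sum_bound:
  assumes abc: abc_conjecture and "\<epsilon> > 0" "g \<ge> 0"
  obtains K :: real where "K > 0"
    "\<And>A B C :: int. A \<noteq> 0 \<Longrightarrow> B \<noteq> 0 \<Longrightarrow> C \<noteq> 0 \<Longrightarrow> A + B = C \<Longrightarrow> real_of_int (Gcd {A, B, C}) \<le> g \<Longrightarrow>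
       real_of_int (\<bar>A\<bar> + \<bar>B\<bar> + \<bar>C\<bar>) \<le> K * real_of_int (rad (A * B * C)) powr (1 + \<epsilon>)"
proof -
  obtain K :: real where K: "K > 0"
    "\<And>A B C :: int. A \<noteq> 0 \<Longrightarrow> B \<noteq> 0 \<Longrightarrow> C \<noteq> 0 \<Longrightarrow> A + B = C \<Longrightarrow> real_of_int (Gcd {A, B, C}) \<le> g \<Longrightarrow>
       real_of_int \<bar>C\<bar> \<le> K * real_of_int (rad (A * B * C)) powr (1 + \<epsilon>)"
    using abc_abs_bound[OF assms] by blast
  show ?thesis
  proof (rule that)
    show "3 * K > 0"
      using K by simp
    fix A B C :: int
    assume *: "A \<noteq> 0" "B \<noteq> 0" "C \<noteq> 0" "A + B = C" "real_of_int (Gcd {A, B, C}) \<le> g"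
    let ?r = "real_of_int (rad (A * B * C)) powr (1 + \<epsilon>)"
    have "real_of_int \<bar>C\<bar> \<le> K * ?r"
      using K(2)[of A B C] * by simp
    moreover have "real_of_int \<bar>A\<bar> \<le> K * ?r"
      using K(2)[of C "- B" A] * by (simp add: ac_simps gcd.commute gcd.left_commute)
    moreover have "real_of_int \<bar>B\<bar> \<le> K * ?r"
      using K(2)[of C "- A" B] * by (simp add: ac_simps gcd.commute gcd.left_commute)
    ultimately show "real_of_int (\<bar>A\<bar> + \<bar>B\<bar> + \<bar>C\<bar>) \<le> 3 * K * ?r"
      by simp
  qed
qed

text \<open>The form in which the conjecture is used. A family of equations \<open>A + B = C\<close> with bounded common
  divisors, whose members grow like \<open>H\<^sup>n\<close> while their radicals grow at most like \<open>H\<^sup>s\<close> with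
  \<open>s < n\<close>, has bounded parameter \<open>H\<close>.\<close>

lemma abc_height_bound:
  fixes s n g c1 c2 :: real
  assumes abc: abc_conjecture and "0 < s" "s < n" "0 \<le> g" "0 < c1" "0 < c2"
  obtains M :: real where
    "\<And>(A::int) (B::int) (C::int) (H::real). A \<noteq> 0 \<Longrightarrow> B \<noteq> 0 \<Longrightarrow> C \<noteq> 0 \<Longrightarrow> A + B = C \<Longrightarrow>
       real_of_int (Gcd {A, B, C}) \<le> g \<Longrightarrow> 1 \<le> H \<Longrightarrow>
       real_of_int (rad (A * B * C)) \<le> c1 * H powr s \<Longrightarrow>
       H powr n \<le> c2 * real_of_int (\<bar>A\<bar> + \<bar>B\<bar> + \<bar>C\<bar>) \<Longrightarrow> H \<le> M"
proof -
  \<comment> \<open>This \<open>\<epsilon>\<close> moves the exponent \<open>s\<close> half of the way to \<open>n\<close>.\<close>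
  define \<epsilon> where "\<epsilon> = (n - s) / (2 * s)"
  have \<epsilon>: "\<epsilon> > 0" and s\<epsilon>: "s * (1 + \<epsilon>) = n - (n - s) / 2"
    using assms by (simp_all add: \<epsilon>_def field_simps)
  obtain K :: real where K: "K > 0"
    "\<And>A B C :: int. A \<noteq> 0 \<Longrightarrow> B \<noteq> 0 \<Longrightarrow> C \<noteq> 0 \<Longrightarrow> A + B = C \<Longrightarrow> real_of_int (Gcd {A, B, C}) \<le> g \<Longrightarrow>
       real_of_int (\<bar>A\<bar> + \<bar>B\<bar> + \<bar>C\<bar>) \<le> K * real_of_int (rad (A * B * C)) powr (1 + \<epsilon>)"
    using abc_sum_bound[OF abc \<epsilon> \<open>0 \<le> g\<close>] by blast
  define D where "D = c2 * K * c1 powr (1 + \<epsilon>)"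
  show ?thesis
  proof (rule that)
    fix A B C :: int and H :: real
    assume *: "A \<noteq> 0" "B \<noteq> 0" "C \<noteq> 0" "A + B = C" "real_of_int (Gcd {A, B, C}) \<le> g"
      and H: "1 \<le> H" and rad: "real_of_int (rad (A * B * C)) \<le> c1 * H powr s"
      and height: "H powr n \<le> c2 * real_of_int (\<bar>A\<bar> + \<bar>B\<bar> + \<bar>C\<bar>)"
    note height
    also have "c2 * real_of_int (\<bar>A\<bar> + \<bar>B\<bar> + \<bar>C\<bar>)
        \<le> c2 * (K * real_of_int (rad (A * B * C)) powr (1 + \<epsilon>))"
      using K(2)[OF *] \<open>0 < c2\<close> by (intro mult_left_mono) auto
    also have "\<dots> \<le> c2 * (K * (c1 * H powr s) powr (1 + \<epsilon>))"
      using rad rad_ge_1[of "A * B * C"] \<epsilon> \<open>0 < c2\<close> K(1)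
      by (intro mult_left_mono powr_mono2) auto
    also have "\<dots> = D * H powr (n - (n - s) / 2)"
      using assms H by (simp add: D_def powr_mult powr_powr s\<epsilon>)
    also have "\<dots> = D * (H powr n / H powr ((n - s) / 2))"
      by (simp add: powr_diff)
    finally have "H powr ((n - s) / 2) \<le> D"
      using H by (simp add: field_simps)
    then have "(H powr ((n - s) / 2)) powr (2 / (n - s)) \<le> D powr (2 / (n - s))"
      using assms by (intro powr_mono2) auto
    moreover have "(n - s) / 2 * (2 / (n - s)) = 1"
      using assms by simp
    ultimately show "H \<le> D powr (2 / (n - s))"
      using H by (simp only: powr_powr) simp
  qed
qed

section \<open>Three consecutive terms\<close>

text \<open>Here the equation is \<open>a + (a + 2 * d) = 2 * (a + d)\<close>, of degree 1. The quantity
  \<open>\<bar>a\<bar> + 2 * \<bar>d\<bar>\<close> serves as height because it bounds all three terms.\<close>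

lemma three_term_height_bound:
  fixes w g C :: real
  assumes abc: abc_conjecture and "0 < w" "w < 1" "0 \<le> g" "0 < C"
  obtains M :: real where
    "\<And>a d :: int. a \<noteq> 0 \<Longrightarrow> a + d \<noteq> 0 \<Longrightarrow> a + 2 * d \<noteq> 0 \<Longrightarrow> real_of_int (gcd a d) \<le> g \<Longrightarrow>
       real_of_int (rad a * rad (a + d) * rad (a + 2 * d))
         \<le> C * real_of_int (\<bar>a\<bar> + 2 * \<bar>d\<bar>) powr w \<Longrightarrow>
       real_of_int (\<bar>a\<bar> + 2 * \<bar>d\<bar>) \<le> M"
proof -
  obtain M :: real where M:
    "\<And>A B E H. A \<noteq> 0 \<Longrightarrow> B \<noteq> 0 \<Longrightarrow> E \<noteq> 0 \<Longrightarrow> A + B = E \<Longrightarrow> real_of_int (Gcd {A, B, E}) \<le> 2 * g \<Longrightarrow>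
       1 \<le> H \<Longrightarrow> real_of_int (rad (A * B * E)) \<le> (2 * C) * H powr w \<Longrightarrow>
       H powr 1 \<le> 2 * real_of_int (\<bar>A\<bar> + \<bar>B\<bar> + \<bar>E\<bar>) \<Longrightarrow> H \<le> M"
    using abc_height_bound[OF abc \<open>0 < w\<close> \<open>w < 1\<close>, of "2 * g" "2 * C" 2] assms by auto
  show ?thesis
  proof (rule that)
    fix a d :: int
    assume nz: "a \<noteq> 0" "a + d \<noteq> 0" "a + 2 * d \<noteq> 0" and gcd: "real_of_int (gcd a d) \<le> g"
      and rad: "real_of_int (rad a * rad (a + d) * rad (a + 2 * d))
        \<le> C * real_of_int (\<bar>a\<bar> + 2 * \<bar>d\<bar>) powr w"
    show "real_of_int (\<bar>a\<bar> + 2 * \<bar>d\<bar>) \<le> M"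
    proof (rule M)
      show "a \<noteq> 0" "a + 2 * d \<noteq> 0" "2 * (a + d) \<noteq> 0" "a + (a + 2 * d) = 2 * (a + d)"
        using nz by simp_all
      let ?G = "Gcd {a, a + 2 * d, 2 * (a + d)}"
      have dvd: "?G dvd a" "?G dvd a + 2 * d"
        by (rule Gcd_dvd; simp)+
      then have "?G dvd 2 * d"
        by (metis dvd_add_right_iff)
      then have "?G dvd gcd (2 * a) (2 * d)"
        using dvd(1) by (intro gcd_greatest) (rule dvd_mult)
      then have "?G dvd 2 * gcd a d"
        by (simp add: gcd_mult_left)
      then have "?G \<le> 2 * gcd a d"
        using nz by (intro zdvd_imp_le) auto
      then show "real_of_int ?G \<le> 2 * g"
        using gcd by linarith
      show "1 \<le> real_of_int (\<bar>a\<bar> + 2 * \<bar>d\<bar>)"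
        using nz by linarith
      have "rad (a * (a + 2 * d) * (2 * (a + d))) \<le> rad (a * (a + 2 * d)) * rad (2 * (a + d))"
        using nz by (intro rad_mult_le) auto
      also have "\<dots> \<le> (rad a * rad (a + 2 * d)) * (rad 2 * rad (a + d))"
        using nz rad_ge_1[of a] rad_ge_1[of "a + 2 * d"] rad_ge_1[of "2 * (a + d)"]
        by (intro mult_mono rad_mult_le) auto
      also have "\<dots> = 2 * (rad a * rad (a + d) * rad (a + 2 * d))"
        by simp
      finally have "real_of_int (rad (a * (a + 2 * d) * (2 * (a + d))))
          \<le> real_of_int (2 * (rad a * rad (a + d) * rad (a + 2 * d)))"
        by (simp only: of_int_le_iff)
      also have "\<dots> \<le> 2 * (C * real_of_int (\<bar>a\<bar> + 2 * \<bar>d\<bar>) powr w)"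
        using rad by simp
      finally show "real_of_int (rad (a * (a + 2 * d) * (2 * (a + d))))
          \<le> (2 * C) * real_of_int (\<bar>a\<bar> + 2 * \<bar>d\<bar>) powr w"
        by (simp only: mult.assoc)
      have "2 * \<bar>d\<bar> \<le> \<bar>a\<bar> + \<bar>a + 2 * d\<bar>"
        by linarith
      then have "\<bar>a\<bar> + 2 * \<bar>d\<bar> \<le> 2 * \<bar>a\<bar> + \<bar>a + 2 * d\<bar>"
        by simp
      also have "2 * p + q \<le> 2 * (p + q + r)" if "0 \<le> q" "0 \<le> r" for p q r :: int
        using that by simp
      then have "2 * \<bar>a\<bar> + \<bar>a + 2 * d\<bar> \<le> 2 * (\<bar>a\<bar> + \<bar>a + 2 * d\<bar> + \<bar>2 * (a + d)\<bar>)"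
        by (meson abs_ge_zero)
      finally have "\<bar>a\<bar> + 2 * \<bar>d\<bar> \<le> 2 * (\<bar>a\<bar> + \<bar>a + 2 * d\<bar> + \<bar>2 * (a + d)\<bar>)" .
      then have "real_of_int (\<bar>a\<bar> + 2 * \<bar>d\<bar>)
          \<le> real_of_int (2 * (\<bar>a\<bar> + \<bar>a + 2 * d\<bar> + \<bar>2 * (a + d)\<bar>))"
        by (simp only: of_int_le_iff)
      moreover have "0 \<le> real_of_int (\<bar>a\<bar> + 2 * \<bar>d\<bar>)"
        by simp
      ultimately show "real_of_int (\<bar>a\<bar> + 2 * \<bar>d\<bar>) powr 1
          \<le> 2 * real_of_int (\<bar>a\<bar> + \<bar>a + 2 * d\<bar> + \<bar>2 * (a + d)\<bar>)"
        by (simp only: powr_one of_int_mult of_int_numeral)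
    qed
  qed
qed

section \<open>Four and five consecutive terms\<close>

text \<open>The identity is \<open>4 + (T\<^sup>2 - 4) = T\<^sup>2\<close> in disguise: with \<open>T = t\<^sup>3 - 3 * t\<close> one has
  \<open>T - 2 = (t + 1)\<^sup>2 * (t - 2)\<close> and \<open>T + 2 = (t - 1)\<^sup>2 * (t + 2)\<close>, so \<open>T\<^sup>2 - 4\<close> is a product of
  linear factors, and together with \<open>T\<^sup>2\<close> it contains all of
  \<open>t - 2, t - 1, t, t + 1, t + 2\<close>. Homogenizing with \<open>d\<close> gives an equation of degree 6 with only
  eight distinct linear factors over the reals, which is the smallest number possible in this degree
  (\<open>t / d \<mapsto> T\<^sup>2 / 4\<close> is a map ramified over three points only).\<close>

lemma sextic_identity:
  fixes t d :: int
  shows "4 * d ^ 6 + ((t - d) * (t + d)) ^ 2 * ((t - 2 * d) * (t + 2 * d)) = (t * (t\<^sup>2 - 3 * d\<^sup>2)) ^ 2"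
  by algebra

text \<open>This keeps the quadratic factor of the sextic identity away from zero.\<close>

lemma square_neq_3_square:
  fixes t d :: int
  assumes "d \<noteq> 0"
  shows "t\<^sup>2 \<noteq> 3 * d\<^sup>2"
proof
  assume eq: "t\<^sup>2 = 3 * d\<^sup>2"
  then have "t \<noteq> 0"
    using assms by auto
  have 3: "prime (3 :: int)"
    by simp
  have "multiplicity 3 (t\<^sup>2) = 2 * multiplicity 3 t"
    using 3 \<open>t \<noteq> 0\<close> by (simp add: prime_elem_multiplicity_power_distrib)
  moreover have "multiplicity 3 (3 * d\<^sup>2) = Suc (2 * multiplicity 3 d)"
    using 3 assms by (simp add: prime_elem_multiplicity_mult_distrib prime_elem_multiplicity_power_distrib)
  ultimately have "2 * multiplicity 3 t = Suc (2 * multiplicity 3 d)"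
    using eq by (simp only:)
  then show False
    by presburger
qed

text \<open>For coprime \<open>t\<close> and \<open>d\<close> the right-hand side of the identity is prime to \<open>d\<close>, so that it can share
  with \<open>4 * d ^ 6\<close> only a divisor of 4. The general case follows by homogeneity.\<close>

lemma sextic_common_divisor:
  fixes t d e :: int
  assumes "d \<noteq> 0" and e: "e dvd 4 * d ^ 6" "e dvd (t * (t\<^sup>2 - 3 * d\<^sup>2)) ^ 2"
  shows "e dvd 4 * gcd t d ^ 6"
proof -
  define G where "G = gcd t d"
  have "G \<noteq> 0"
    using assms by (simp add: G_def)
  then obtain t' d' where t: "t = t' * G" and d: "d = d' * G" and cop: "coprime t' d'"
    using gcd_coprime_exists[of t d] unfolding G_def by blast
  let ?A = "4 * d' ^ 6" and ?C = "(t' * (t'\<^sup>2 - 3 * d'\<^sup>2)) ^ 2"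
  have "coprime (t'\<^sup>2 - 3 * d'\<^sup>2) d'"
  proof (rule coprimeI)
    fix c assume c: "c dvd t'\<^sup>2 - 3 * d'\<^sup>2" "c dvd d'"
    then have "c dvd (t'\<^sup>2 - 3 * d'\<^sup>2) + 3 * d' * d'"
      by (intro dvd_add dvd_mult)
    then have "c dvd t'\<^sup>2"
      by (simp add: power2_eq_square)
    moreover have "coprime (t'\<^sup>2) d'"
      using cop by simp
    ultimately show "is_unit c"
      using c(2) by (meson coprime_common_divisor)
  qed
  then have "coprime ?C (d' ^ 6)"
    using cop by simp
  then have "coprime (gcd ?A ?C) (d' ^ 6)"
    by (meson coprime_divisors dvd_refl gcd_dvd2)
  moreover have "gcd ?A ?C dvd 4 * d' ^ 6"
    by simp
  ultimately have 4: "gcd ?A ?C dvd 4"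
    by (simp only: coprime_dvd_mult_left_iff)
  have "4 * d ^ 6 = G ^ 6 * ?A" "(t * (t\<^sup>2 - 3 * d\<^sup>2)) ^ 2 = G ^ 6 * ?C"
    unfolding t d by algebra+
  then have "e dvd gcd (G ^ 6 * ?A) (G ^ 6 * ?C)"
    using e by (metis gcd_greatest)
  also have "\<dots> dvd G ^ 6 * gcd ?A ?C"
    by (simp only: gcd_mult_left) simp
  also have "\<dots> dvd G ^ 6 * 4"
    using 4 by (rule mult_dvd_mono[OF dvd_refl])
  finally show ?thesis
    by (simp add: G_def mult.commute)
qed

text \<open>Either \<open>d\<close> is comparable with the height, and then \<open>4 * d ^ 6\<close> is large, or \<open>t\<close> dominates \<open>d\<close>, and
  then the square behaves like \<open>t ^ 6\<close>.\<close>

lemma sextic_height: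
  fixes t d :: int
  shows "(\<bar>t\<bar> + 2 * \<bar>d\<bar>) ^ 6 \<le> 1024 * (4 * d ^ 6 + (t * (t\<^sup>2 - 3 * d\<^sup>2)) ^ 2)"
proof (cases "\<bar>t\<bar> \<le> 2 * \<bar>d\<bar>")
  case True
  then have "(\<bar>t\<bar> + 2 * \<bar>d\<bar>) ^ 6 \<le> (4 * \<bar>d\<bar>) ^ 6"
    by (intro power_mono) auto
  also have "\<dots> = 4096 * d ^ 6"
    by (simp add: power_mult_distrib power_even_abs)
  also have "4096 * x \<le> 1024 * (4 * x + y\<^sup>2)" for x y :: int
    by simp
  finally show ?thesis .
next
  case False
  then have "(2 * \<bar>d\<bar>)\<^sup>2 \<le> \<bar>t\<bar>\<^sup>2"
    by (intro power_mono) auto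
  then have "t\<^sup>2 \<le> 4 * (t\<^sup>2 - 3 * d\<^sup>2)"
    by (simp add: power_mult_distrib)
  then have "(t\<^sup>2)\<^sup>2 \<le> (4 * (t\<^sup>2 - 3 * d\<^sup>2))\<^sup>2"
    by (intro power_mono) auto
  then have "t\<^sup>2 * (t\<^sup>2)\<^sup>2 \<le> t\<^sup>2 * (4 * (t\<^sup>2 - 3 * d\<^sup>2))\<^sup>2"
    by (intro mult_left_mono) auto
  moreover have "t\<^sup>2 * (t\<^sup>2)\<^sup>2 = t ^ 6"
    "t\<^sup>2 * (4 * (t\<^sup>2 - 3 * d\<^sup>2))\<^sup>2 = 16 * (t * (t\<^sup>2 - 3 * d\<^sup>2)) ^ 2"
    by algebra+
  ultimately have t6: "t ^ 6 \<le> 16 * (t * (t\<^sup>2 - 3 * d\<^sup>2)) ^ 2"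
    by (simp only:)
  have "(\<bar>t\<bar> + 2 * \<bar>d\<bar>) ^ 6 \<le> (2 * \<bar>t\<bar>) ^ 6"
    using False by (intro power_mono) auto
  also have "\<dots> = 64 * t ^ 6"
    by (simp add: power_mult_distrib power_even_abs)
  also have "\<dots> \<le> 1024 * (t * (t\<^sup>2 - 3 * d\<^sup>2)) ^ 2"
    using t6 by simp
  also have "\<dots> \<le> 1024 * (4 * d ^ 6 + (t * (t\<^sup>2 - 3 * d\<^sup>2)) ^ 2)"
    by simp
  finally show ?thesis .
qed

lemma rad_mult_le_mult:
  assumes "x \<noteq> 0" "y \<noteq> 0" "rad x \<le> X" "rad y \<le> Y"
  shows "rad (x * y) \<le> X * Y"
proof -
  have "rad x * rad y \<le> X * Y"
    using assms rad_ge_1[of x] rad_ge_1[of y] by (intro mult_mono) auto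
  then show ?thesis
    using rad_mult_le[of x y] assms by linarith
qed

text \<open>Apart from the prime 2 and the five terms, the radical only sees \<open>d\<close> and the quadratic factor, of joint degree 3.\<close>

lemma rad_sextic_le:
  fixes t d :: int
  assumes nz: "d \<noteq> 0" "t \<noteq> 0" "t - d \<noteq> 0" "t + d \<noteq> 0" "t - 2 * d \<noteq> 0" "t + 2 * d \<noteq> 0"
  shows "rad (4 * d ^ 6 * (((t - d) * (t + d)) ^ 2 * ((t - 2 * d) * (t + 2 * d))) *
              (t * (t\<^sup>2 - 3 * d\<^sup>2)) ^ 2)
       \<le> 2 * (\<bar>t\<bar> + 2 * \<bar>d\<bar>) ^ 3 *
          (rad (t - 2 * d) * rad (t - d) * rad t * rad (t + d) * rad (t + 2 * d))"
    (is "?L \<le> 2 * ?H ^ 3 * ?R")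
proof -
  let ?q = "t\<^sup>2 - 3 * d\<^sup>2"
  have q: "?q \<noteq> 0"
    using square_neq_3_square nz by simp
  have "rad 4 = rad (2 ^ 2)"
    by simp
  then have 4: "rad 4 = 2"
    by (subst (asm) rad_power) simp_all
  have R: "0 \<le> ?R"
    using rad_ge_1[of t] rad_ge_1[of "t - d"] rad_ge_1[of "t + d"]
      rad_ge_1[of "t - 2 * d"] rad_ge_1[of "t + 2 * d"] by (intro mult_nonneg_nonneg) auto
  have "?L \<le> (2 * \<bar>d\<bar>) * ((rad (t - d) * rad (t + d)) * (rad (t - 2 * d) * rad (t + 2 * d)))
      * (rad t * \<bar>?q\<bar>)"
    using nz q by (intro rad_mult_le_mult)
      (auto simp: rad_power rad_le_abs 4 intro!: rad_mult_le_mult)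
  also have "\<dots> = (2 * (\<bar>d\<bar> * \<bar>?q\<bar>)) * ?R"
    by simp
  also have "\<dots> \<le> (2 * (?H * ?H ^ 2)) * ?R"
  proof (intro mult_right_mono mult_left_mono mult_mono)
    have "\<bar>?q\<bar> \<le> t\<^sup>2 + 3 * d\<^sup>2"
      using zero_le_power2[of t] zero_le_power2[of d] by linarith
    also have "\<dots> \<le> \<bar>t\<bar>\<^sup>2 + 4 * \<bar>d\<bar>\<^sup>2 + 4 * (\<bar>t\<bar> * \<bar>d\<bar>)"
      by simp
    also have "\<dots> = ?H\<^sup>2"
      by (simp only: power2_sum power_mult_distrib) simp
    finally show "\<bar>?q\<bar> \<le> ?H\<^sup>2" .
  qed (use R in auto)
  also have "\<dots> = 2 * ?H ^ 3 * ?R"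
    by (simp add: power3_eq_cube power2_eq_square)
  finally show ?thesis .
qed

text \<open>The degree of the identity is 6 and the factors that are not terms of the progression use up 3,
  so it is enough that the radicals of the five terms together have order less than 3.\<close>

lemma five_term_height_bound:
  fixes w g C :: real
  assumes abc: abc_conjecture and "0 < w" "w < 3" "0 \<le> g" "0 < C"
  obtains M :: real where
    "\<And>t d :: int. d \<noteq> 0 \<Longrightarrow> t \<noteq> 0 \<Longrightarrow> t - d \<noteq> 0 \<Longrightarrow> t + d \<noteq> 0 \<Longrightarrow> t - 2 * d \<noteq> 0 \<Longrightarrow> t + 2 * d \<noteq> 0 \<Longrightarrow>
       real_of_int (gcd t d) \<le> g \<Longrightarrow>
       real_of_int (rad (t - 2 * d) * rad (t - d) * rad t * rad (t + d) * rad (t + 2 * d))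
         \<le> C * real_of_int (\<bar>t\<bar> + 2 * \<bar>d\<bar>) powr w \<Longrightarrow>
       real_of_int (\<bar>t\<bar> + 2 * \<bar>d\<bar>) \<le> M"
proof -
  have "3 + w < 6"
    using assms by simp
  obtain M :: real where M:
    "\<And>A B E H. A \<noteq> 0 \<Longrightarrow> B \<noteq> 0 \<Longrightarrow> E \<noteq> 0 \<Longrightarrow> A + B = E \<Longrightarrow> real_of_int (Gcd {A, B, E}) \<le> 4 * g ^ 6 \<Longrightarrow>
       1 \<le> H \<Longrightarrow> real_of_int (rad (A * B * E)) \<le> (2 * C) * H powr (3 + w) \<Longrightarrow>
       H powr 6 \<le> 1024 * real_of_int (\<bar>A\<bar> + \<bar>B\<bar> + \<bar>E\<bar>) \<Longrightarrow> H \<le> M"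
    using abc_height_bound[OF abc _ \<open>3 + w < 6\<close>, of "4 * g ^ 6" "2 * C" 1024] assms by auto
  show ?thesis
  proof (rule that)
    fix t d :: int
    assume nz: "d \<noteq> 0" "t \<noteq> 0" "t - d \<noteq> 0" "t + d \<noteq> 0" "t - 2 * d \<noteq> 0" "t + 2 * d \<noteq> 0"
      and gcd: "real_of_int (gcd t d) \<le> g"
      and rad: "real_of_int (rad (t - 2 * d) * rad (t - d) * rad t * rad (t + d) * rad (t + 2 * d))
        \<le> C * real_of_int (\<bar>t\<bar> + 2 * \<bar>d\<bar>) powr w"
    let ?A = "4 * d ^ 6" and ?B = "((t - d) * (t + d)) ^ 2 * ((t - 2 * d) * (t + 2 * d))"
      and ?E = "(t * (t\<^sup>2 - 3 * d\<^sup>2)) ^ 2"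
    define H where "H = real_of_int (\<bar>t\<bar> + 2 * \<bar>d\<bar>)"
    have H: "1 \<le> H"
      unfolding H_def using nz by linarith
    have "H \<le> M"
    proof (rule M)
      show "?A \<noteq> 0" "?B \<noteq> 0" "?E \<noteq> 0"
        using nz square_neq_3_square[of d t] by simp_all
      show "?A + ?B = ?E"
        by (rule sextic_identity)
      let ?G = "Gcd {?A, ?B, ?E}"
      have "?G dvd ?A" "?G dvd ?E"
        by (rule Gcd_dvd; simp)+
      then have "?G dvd 4 * gcd t d ^ 6"
        using sextic_common_divisor nz by blast
      then have "?G \<le> 4 * gcd t d ^ 6"
        using nz by (intro zdvd_imp_le) auto
      then have "real_of_int ?G \<le> real_of_int (4 * gcd t d ^ 6)"
        by (simp only: of_int_le_iff)
      also have "\<dots> \<le> 4 * g ^ 6"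
        using power_mono[OF gcd, of 6] by simp
      finally show "real_of_int ?G \<le> 4 * g ^ 6" .
      have "real_of_int (rad (?A * ?B * ?E)) \<le> real_of_int (2 * (\<bar>t\<bar> + 2 * \<bar>d\<bar>) ^ 3 *
          (rad (t - 2 * d) * rad (t - d) * rad t * rad (t + d) * rad (t + 2 * d)))"
        using rad_sextic_le[OF nz] by (simp only: of_int_le_iff)
      also have "\<dots> = 2 * H ^ 3 *
          real_of_int (rad (t - 2 * d) * rad (t - d) * rad t * rad (t + d) * rad (t + 2 * d))"
        by (simp only: H_def of_int_mult of_int_power of_int_numeral)
      also have "\<dots> \<le> 2 * H ^ 3 * (C * H powr w)"
        using rad H by (intro mult_left_mono) (auto simp: H_def)
      also have "\<dots> = (2 * C) * H powr (3 + w)"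
        using H by (simp add: powr_add powr_numeral)
      finally show "real_of_int (rad (?A * ?B * ?E)) \<le> (2 * C) * H powr (3 + w)" .
      have "(\<bar>t\<bar> + 2 * \<bar>d\<bar>) ^ 6 \<le> 1024 * (?A + ?E)"
        by (rule sextic_height)
      also have "1024 * (x + z) \<le> 1024 * (\<bar>x\<bar> + \<bar>y\<bar> + \<bar>z\<bar>)" for x y z :: int
        by (smt (verit))
      finally have "real_of_int ((\<bar>t\<bar> + 2 * \<bar>d\<bar>) ^ 6) \<le> real_of_int (1024 * (\<bar>?A\<bar> + \<bar>?B\<bar> + \<bar>?E\<bar>))"
        unfolding of_int_le_iff .
      moreover have "H powr 6 = real_of_int ((\<bar>t\<bar> + 2 * \<bar>d\<bar>) ^ 6)"
        using H by (simp add: powr_numeral) (simp add: H_def)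
      ultimately show "H powr 6 \<le> 1024 * real_of_int (\<bar>?A\<bar> + \<bar>?B\<bar> + \<bar>?E\<bar>)"
        by (simp only: of_int_mult of_int_numeral)
    qed (rule H)
    then show "real_of_int (\<bar>t\<bar> + 2 * \<bar>d\<bar>) \<le> M"
      by (simp only: H_def)
  qed
qed

section \<open>Progressions of almost perfect powers\<close>

text \<open>The progression is given by its first term and its difference, so that cutting out a block of
  consecutive terms amounts to changing \<open>a\<close> and shifting \<open>\<eta>\<close>, \<open>x\<close> and \<open>l\<close>.\<close>

definition power_prog ::
  "nat \<Rightarrow> nat \<Rightarrow> int \<Rightarrow> int \<Rightarrow> (nat \<Rightarrow> int) \<Rightarrow> (nat \<Rightarrow> int) \<Rightarrow> (nat \<Rightarrow> nat) \<Rightarrow> bool" where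
  "power_prog \<alpha> k a d \<eta> x l \<longleftrightarrow> (\<forall>i < k. is_rep \<alpha> (a + int i * d) (\<eta> i) (x i) (l i))"

lemma rad_prod_le_root:
  fixes H :: int
  assumes "finite I" "1 \<le> H" "0 < \<alpha>"
    and rep: "\<And>i. i \<in> I \<Longrightarrow> is_rep \<alpha> (f i) (\<eta> i) (x i) (l i)"
    and le: "\<And>i. i \<in> I \<Longrightarrow> \<bar>f i\<bar> \<le> H"
    and w: "(\<Sum>i\<in>I. 1 / real (l i)) \<le> w"
  shows "real_of_int (\<Prod>i\<in>I. rad (f i)) \<le> real \<alpha> ^ card I * real_of_int H powr w"
proof -
  have "real_of_int (\<Prod>i\<in>I. rad (f i)) = (\<Prod>i\<in>I. real_of_int (rad (f i)))"
    by simp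
  also have "\<dots> \<le> (\<Prod>i\<in>I. real \<alpha> * real_of_int H powr (1 / real (l i)))"
  proof (intro prod_mono conjI)
    fix i assume "i \<in> I"
    then show "real_of_int (rad (f i)) \<le> real \<alpha> * real_of_int H powr (1 / real (l i))"
      using rad_le_root[OF rep] le by (simp only: of_int_le_iff)
    show "0 \<le> real_of_int (rad (f i))"
      using rad_ge_1[of "f i"] by simp
  qed
  also have "\<dots> = real \<alpha> ^ card I * real_of_int H powr (\<Sum>i\<in>I. 1 / real (l i))"
    using assms by (simp add: prod.distrib powr_sum)
  also have "\<dots> \<le> real \<alpha> ^ card I * real_of_int H powr w"
    using w \<open>1 \<le> H\<close> by (intro mult_left_mono powr_mono) auto
  finally show ?thesis .
qed

lemma is_rep_nonzero: "is_rep \<alpha> h \<eta> x l \<Longrightarrow> h \<noteq> 0"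
  by (auto simp: is_rep_def)

lemma is_rep_inverse_exponent_le:
  "is_rep \<alpha> h \<eta> x l \<Longrightarrow> 1 / real l \<le> 1 / 2"
  by (auto simp: is_rep_def intro!: divide_left_mono)

lemma gcd_shift: "gcd (a + c * d) d = gcd a d" for a c d :: int
  using gcd_add_mult[of d c a] by (simp add: gcd.commute add.commute)

lemma three_powers_bounded:
  fixes w g :: real
  assumes abc: abc_conjecture and "0 < w" "w < 1" "0 \<le> g" "0 < \<alpha>"
  obtains M :: real where
    "\<And>a d \<eta> x l i. power_prog \<alpha> 3 a d \<eta> x l \<Longrightarrow>
       (\<Sum>i<3. 1 / real (l i)) \<le> w \<Longrightarrow> real_of_int (gcd a d) \<le> g \<Longrightarrow> i < (3::nat) \<Longrightarrow>
       real_of_int \<bar>a + int i * d\<bar> \<le> M"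
proof -
  obtain M :: real where M:
    "\<And>a d :: int. a \<noteq> 0 \<Longrightarrow> a + d \<noteq> 0 \<Longrightarrow> a + 2 * d \<noteq> 0 \<Longrightarrow> real_of_int (gcd a d) \<le> g \<Longrightarrow>
       real_of_int (rad a * rad (a + d) * rad (a + 2 * d))
         \<le> real \<alpha> ^ 3 * real_of_int (\<bar>a\<bar> + 2 * \<bar>d\<bar>) powr w \<Longrightarrow>
       real_of_int (\<bar>a\<bar> + 2 * \<bar>d\<bar>) \<le> M"
    using three_term_height_bound[OF abc, of w g "real \<alpha> ^ 3"] assms by auto
  show ?thesis
  proof (rule that)
    fix a d \<eta> x l and i :: nat
    assume prog: "power_prog \<alpha> 3 a d \<eta> x l"
      and w: "(\<Sum>i<3. 1 / real (l i)) \<le> w" and gcd: "real_of_int (gcd a d) \<le> g" and "i < 3"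
    have rep: "is_rep \<alpha> (a + int i * d) (\<eta> i) (x i) (l i)" if "i < 3" for i
      using prog that by (simp add: power_prog_def)
    define H where "H = \<bar>a\<bar> + 2 * \<bar>d\<bar>"
    have nz: "a \<noteq> 0" "a + d \<noteq> 0" "a + 2 * d \<noteq> 0"
      using rep[of 0] rep[of 1] rep[of 2] by (auto dest: is_rep_nonzero)
    have le: "\<bar>a + int i * d\<bar> \<le> H" if "i < 3" for i
    proof -
      have "i = 0 \<or> i = 1 \<or> i = 2"
        using that by auto
      then show ?thesis
        by (auto simp: H_def)
    qed
    have "real_of_int (\<Prod>i<3. rad (a + int i * d)) \<le> real \<alpha> ^ card {..<3::nat} * real_of_int H powr w"
    proof (rule rad_prod_le_root)
      show "1 \<le> H"
        unfolding H_def using nz by linarith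
    qed (use rep w le \<open>0 < \<alpha>\<close> in auto)
    then have "real_of_int H \<le> M"
      unfolding H_def using nz gcd by (intro M) (simp_all add: eval_nat_numeral)
    then show "real_of_int \<bar>a + int i * d\<bar> \<le> M"
      using le[OF \<open>i < 3\<close>] by linarith
  qed
qed

text \<open>Exponents at least 2 make the radicals of five terms at most of order \<open>5 / 2\<close>, which is less than 3.\<close>

lemma five_powers_bounded:
  fixes g :: real
  assumes abc: abc_conjecture and "0 \<le> g" "0 < \<alpha>"
  obtains M :: real where
    "\<And>a d \<eta> x l i. power_prog \<alpha> 5 a d \<eta> x l \<Longrightarrow>
       d \<noteq> 0 \<Longrightarrow> real_of_int (gcd a d) \<le> g \<Longrightarrow> i < (5::nat) \<Longrightarrow>
       real_of_int \<bar>a + int i * d\<bar> \<le> M"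
proof -
  obtain M :: real where M:
    "\<And>t d :: int. d \<noteq> 0 \<Longrightarrow> t \<noteq> 0 \<Longrightarrow> t - d \<noteq> 0 \<Longrightarrow> t + d \<noteq> 0 \<Longrightarrow> t - 2 * d \<noteq> 0 \<Longrightarrow> t + 2 * d \<noteq> 0 \<Longrightarrow>
       real_of_int (gcd t d) \<le> g \<Longrightarrow>
       real_of_int (rad (t - 2 * d) * rad (t - d) * rad t * rad (t + d) * rad (t + 2 * d))
         \<le> real \<alpha> ^ 5 * real_of_int (\<bar>t\<bar> + 2 * \<bar>d\<bar>) powr (5 / 2) \<Longrightarrow>
       real_of_int (\<bar>t\<bar> + 2 * \<bar>d\<bar>) \<le> M"
    using five_term_height_bound[OF abc, of "5 / 2" g "real \<alpha> ^ 5"] assms by auto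
  show ?thesis
  proof (rule that)
    fix a d \<eta> x l and i :: nat
    assume prog: "power_prog \<alpha> 5 a d \<eta> x l"
      and d: "d \<noteq> 0" and gcd: "real_of_int (gcd a d) \<le> g" and "i < 5"
    have rep: "is_rep \<alpha> (a + int i * d) (\<eta> i) (x i) (l i)" if "i < 5" for i
      using prog that by (simp add: power_prog_def)
    define t where "t = a + 2 * d"
    define H where "H = \<bar>t\<bar> + 2 * \<bar>d\<bar>"
    have nz: "t \<noteq> 0" "t - d \<noteq> 0" "t + d \<noteq> 0" "t - 2 * d \<noteq> 0" "t + 2 * d \<noteq> 0"
      using rep[of 0] rep[of 1] rep[of 2] rep[of 3] rep[of 4]
      by (auto dest!: is_rep_nonzero simp: t_def)
    have le: "\<bar>a + int i * d\<bar> \<le> H" if "i < 5" for i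
    proof -
      have "i = 0 \<or> i = 1 \<or> i = 2 \<or> i = 3 \<or> i = 4"
        using that by auto
      then show ?thesis
        by (elim disjE; simp add: H_def t_def)
    qed
    have "(\<Sum>i<5. 1 / real (l i)) \<le> (\<Sum>i<(5::nat). 1 / 2)"
      using rep by (intro sum_mono is_rep_inverse_exponent_le) auto
    then have w: "(\<Sum>i<5. 1 / real (l i)) \<le> 5 / 2"
      by simp
    have "real_of_int (\<Prod>i<5. rad (a + int i * d))
        \<le> real \<alpha> ^ card {..<5::nat} * real_of_int H powr (5 / 2)"
    proof (rule rad_prod_le_root)
      show "1 \<le> H"
        unfolding H_def using nz by linarith
    qed (use rep w le \<open>0 < \<alpha>\<close> in auto)
    moreover have "(\<Prod>i<5. rad (a + int i * d))
        = rad (t - 2 * d) * rad (t - d) * rad t * rad (t + d) * rad (t + 2 * d)"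
      by (simp add: eval_nat_numeral t_def algebra_simps)
    moreover have "gcd t d = gcd a d"
      unfolding t_def by (rule gcd_shift)
    ultimately have "real_of_int H \<le> M"
      unfolding H_def using nz d gcd by (intro M) simp_all
    then show "real_of_int \<bar>a + int i * d\<bar> \<le> M"
      using le[OF \<open>i < 5\<close>] by linarith
  qed
qed

text \<open>The term that precedes the four given ones completes them to five. Nothing is known about it, so
  that its radical has order 1, but \<open>1 + 1 / 2 + 1 / 2 + 1 / 2 + 1 / 3 = 17 / 6\<close> is still less than 3.
  With four exponents equal to 2 the total would be exactly 3, which is why one exponent has to
  be at least 3.\<close>

lemma four_powers_bounded:
  fixes g :: real
  assumes abc: abc_conjecture and "0 \<le> g" "0 < \<alpha>"
  obtains M :: real where
    "\<And>a d \<eta> x l i j. power_prog \<alpha> 4 a d \<eta> x l \<Longrightarrow>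
       d \<noteq> 0 \<Longrightarrow> real_of_int (gcd a d) \<le> g \<Longrightarrow> j < (4::nat) \<Longrightarrow> 3 \<le> l j \<Longrightarrow> i < (4::nat) \<Longrightarrow>
       real_of_int \<bar>a + int i * d\<bar> \<le> M"
proof -
  obtain M :: real where M:
    "\<And>t d :: int. d \<noteq> 0 \<Longrightarrow> t \<noteq> 0 \<Longrightarrow> t - d \<noteq> 0 \<Longrightarrow> t + d \<noteq> 0 \<Longrightarrow> t - 2 * d \<noteq> 0 \<Longrightarrow> t + 2 * d \<noteq> 0 \<Longrightarrow>
       real_of_int (gcd t d) \<le> g \<Longrightarrow>
       real_of_int (rad (t - 2 * d) * rad (t - d) * rad t * rad (t + d) * rad (t + 2 * d))
         \<le> real \<alpha> ^ 4 * real_of_int (\<bar>t\<bar> + 2 * \<bar>d\<bar>) powr (17 / 6) \<Longrightarrow>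
       real_of_int (\<bar>t\<bar> + 2 * \<bar>d\<bar>) \<le> M"
    using five_term_height_bound[OF abc, of "17 / 6" g "real \<alpha> ^ 4"] assms by auto
  show ?thesis
  proof (rule that)
    fix a d \<eta> x l and i j :: nat
    assume prog: "power_prog \<alpha> 4 a d \<eta> x l"
      and d: "d \<noteq> 0" and gcd: "real_of_int (gcd a d) \<le> g" and j: "j < 4" "3 \<le> l j" and "i < 4"
    have rep: "is_rep \<alpha> (a + int i * d) (\<eta> i) (x i) (l i)" if "i < 4" for i
      using prog that by (simp add: power_prog_def)
    define t where "t = a + d"
    define H where "H = \<bar>t\<bar> + 2 * \<bar>d\<bar>"
    have nz: "t \<noteq> 0" "t - d \<noteq> 0" "t + d \<noteq> 0" "t + 2 * d \<noteq> 0"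
      using rep[of 0] rep[of 1] rep[of 2] rep[of 3]
      by (auto dest!: is_rep_nonzero simp: t_def)
    have le: "\<bar>a + int i * d\<bar> \<le> H" if "i < 4" for i
    proof -
      have "i = 0 \<or> i = 1 \<or> i = 2 \<or> i = 3"
        using that by auto
      then show ?thesis
        by (elim disjE; simp add: H_def t_def)
    qed
    have gcd_t: "gcd t d = gcd a d"
      by (simp add: t_def)
    have H1: "1 \<le> H"
      unfolding H_def using nz by linarith
    have "real_of_int H \<le> max M (4 * g)"
    proof (cases "t - 2 * d = 0")
      \<comment> \<open>The added term may vanish; then \<open>d\<close> divides the whole progression and is at most \<open>g\<close>.\<close>
      case True
      then have "t = 2 * d"
        by simp
      then have "gcd t d = \<bar>d\<bar>" "H = 4 * \<bar>d\<bar>"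
        by (simp_all add: H_def)
      then show ?thesis
        using gcd gcd_t by simp
    next
      case False
      have "(\<Sum>i<4. 1 / real (l i)) = 1 / real (l j) + (\<Sum>i\<in>{..<4} - {j}. 1 / real (l i))"
        using j by (simp add: sum.remove)
      also have "\<dots> \<le> 1 / 3 + (\<Sum>i\<in>{..<4::nat} - {j}. 1 / 2)"
        using j rep by (intro add_mono sum_mono is_rep_inverse_exponent_le) (auto intro!: divide_left_mono)
      also have "\<dots> = 11 / 6"
        using j by simp
      finally have w: "(\<Sum>i<4. 1 / real (l i)) \<le> 11 / 6" .
      have "real_of_int (\<Prod>i<4. rad (a + int i * d))
          \<le> real \<alpha> ^ card {..<4::nat} * real_of_int H powr (11 / 6)"
        by (rule rad_prod_le_root) (use rep w le H1 \<open>0 < \<alpha>\<close> in auto)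
      moreover have "(\<Prod>i<4. rad (a + int i * d)) = rad (t - d) * rad t * rad (t + d) * rad (t + 2 * d)"
        by (simp add: eval_nat_numeral t_def algebra_simps)
      ultimately have four: "real_of_int (rad (t - d) * rad t * rad (t + d) * rad (t + 2 * d))
          \<le> real \<alpha> ^ 4 * real_of_int H powr (11 / 6)"
        by simp
      have "rad (t - 2 * d) \<le> H"
        using rad_le_abs[OF False] by (simp add: H_def)
      then have "real_of_int (rad (t - 2 * d))
            * real_of_int (rad (t - d) * rad t * rad (t + d) * rad (t + 2 * d))
          \<le> real_of_int H * (real \<alpha> ^ 4 * real_of_int H powr (11 / 6))"
        using four H1 rad_ge_1[of t] rad_ge_1[of "t - d"] rad_ge_1[of "t + d"] rad_ge_1[of "t + 2 * d"]
        by (intro mult_mono) auto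
      also have "\<dots> = real \<alpha> ^ 4 * (real_of_int H powr 1 * real_of_int H powr (11 / 6))"
        using H1 by simp
      also have "real_of_int H powr 1 * real_of_int H powr (11 / 6) = real_of_int H powr (17 / 6)"
        by (subst powr_add[symmetric]) simp
      finally have "real_of_int H \<le> M"
        unfolding H_def using nz d gcd gcd_t False by (intro M) (simp_all add: mult.assoc)
      then show ?thesis
        by simp
    qed
    then show "real_of_int \<bar>a + int i * d\<bar> \<le> max M (4 * g)"
      using le[OF \<open>i < 4\<close>] by linarith
  qed
qed

section \<open>Bounds on lengths and exponents\<close>

lemma represented_progE:
  assumes "represented_prog \<alpha> c\<^sub>0 h \<eta> x l"
  obtains a d where "d \<noteq> 0" "2 \<le> length h" "real_of_int (gcd a d) \<le> c\<^sub>0"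
    "\<forall>i < length h. h ! i = a + int i * d" "power_prog \<alpha> (length h) a d \<eta> x l"
proof -
  from assms obtain a d where h: "\<And>i. i < length h \<Longrightarrow> h ! i = a + int i * d"
    unfolding represented_prog_def arith_prog_def by blast
  from assms obtain i j where ij: "i < length h" "j < length h" "h ! i \<noteq> h ! j"
    unfolding represented_prog_def nonconstant_def by blast
  then have "2 \<le> length h"
    by (cases "i = j") auto
  show ?thesis
  proof (rule that)
    show "d \<noteq> 0"
      using ij h by auto
    show "2 \<le> length h" by fact
    have "0 < length h" "1 < length h"
      using \<open>2 \<le> length h\<close> by linarith+
    from this[THEN h] have "h ! 0 = a" "h ! 1 = a + d"
      by simp_all
    then have "gcd (h ! 0) (h ! 1) = gcd a (a + d)"
      by simp
    also have "\<dots> = gcd a d"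
      by simp
    finally show "real_of_int (gcd a d) \<le> c\<^sub>0"
      using assms by (simp add: represented_prog_def)
    show "\<forall>i < length h. h ! i = a + int i * d"
      using h by simp
    show "power_prog \<alpha> (length h) a d \<eta> x l"
      using assms h by (simp add: power_prog_def represented_prog_def)
  qed
qed

text \<open>Every term of a progression of length \<open>k\<close> lies in a block of \<open>m\<close> consecutive terms. This carries a
  bound on all terms of progressions of length \<open>m\<close> over to longer ones with the same constant.\<close>

lemma window:
  assumes prog: "power_prog \<alpha> k a d \<eta> x l"
    and gcd: "real_of_int (gcd a d) \<le> g" and "0 < m" "m \<le> k" "i < k"
  obtains a' s j where "a + int i * d = a' + int j * d" "j < m" "s + m \<le> k"
    "real_of_int (gcd a' d) \<le> g"
    "power_prog \<alpha> m a' d (\<lambda>i. \<eta> (s + i)) (\<lambda>i. x (s + i)) (\<lambda>i. l (s + i))"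
proof -
  define s where "s = min i (k - m)"
  have s: "s \<le> i" "i - s < m" "s + m \<le> k"
    using assms by (auto simp: s_def)
  show ?thesis
  proof (rule that)
    show "a + int i * d = (a + int s * d) + int (i - s) * d"
      using s by (simp add: of_nat_diff algebra_simps)
    show "i - s < m" "s + m \<le> k"
      by fact+
    show "real_of_int (gcd (a + int s * d) d) \<le> g"
      using gcd by (simp only: gcd_shift)
    show "power_prog \<alpha> m (a + int s * d) d (\<lambda>i. \<eta> (s + i)) (\<lambda>i. x (s + i)) (\<lambda>i. l (s + i))"
      unfolding power_prog_def
    proof (intro allI impI)
      fix i assume "i < m"
      then have "is_rep \<alpha> (a + int (s + i) * d) (\<eta> (s + i)) (x (s + i)) (l (s + i))"
        using prog s(3) by (simp only: power_prog_def)
      then show "is_rep \<alpha> (a + int s * d + int i * d) (\<eta> (s + i)) (x (s + i)) (l (s + i))"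
        by (simp add: algebra_simps)
    qed
  qed
qed

text \<open>This is the least favourable case \<open>1 / 2 + 1 / 3 + 1 / 7\<close>; with 6 in place of 7 the sum would be 1.\<close>

lemma three_exponents_sum_le:
  assumes nd: "nondegenerate 3 l" and ge: "\<And>i. i < 3 \<Longrightarrow> 2 \<le> l i" and i: "i < 3" "7 \<le> l i"
  shows "(\<Sum>i<3. 1 / real (l i)) \<le> 41 / 42"
proof -
  define I where "I = {..<3::nat} - {i}"
  have I: "card I = 2" "i \<notin> I" "finite I"
    using i by (auto simp: I_def)
  have "\<not> I \<subseteq> {i. i < 3 \<and> l i = 2}"
  proof
    assume "I \<subseteq> {i. i < 3 \<and> l i = 2}"
    then have "card I \<le> card {i. i < 3 \<and> l i = 2}"
      by (intro card_mono) auto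
    then show False
      using nd I by (simp add: nondegenerate_def)
  qed
  then obtain j where j: "j \<in> I" "l j \<noteq> 2"
    by (auto simp: I_def)
  then have "3 \<le> l j"
    using ge[of j] by (simp add: I_def)
  have "card (I - {j}) = 1"
    using I j by simp
  then obtain m where m: "I - {j} = {m}"
    by (auto simp: card_1_singleton_iff)
  then have "2 \<le> l m"
    using ge[of m] by (auto simp: I_def)
  have "(\<Sum>i<3. 1 / real (l i)) = 1 / real (l i) + (\<Sum>i\<in>I. 1 / real (l i))"
    using i by (simp add: I_def sum.remove)
  also have "(\<Sum>i\<in>I. 1 / real (l i)) = 1 / real (l j) + 1 / real (l m)"
    using I j m by (simp add: sum.remove)
  also have "1 / real (l i) + (1 / real (l j) + 1 / real (l m)) \<le> 1 / 7 + (1 / 3 + 1 / 2)"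
    using i \<open>3 \<le> l j\<close> \<open>2 \<le> l m\<close> by (intro add_mono divide_left_mono) auto
  finally show ?thesis
    by simp
qed

lemma max_exponent_less:
  assumes "0 < c" "\<And>i. i < k \<Longrightarrow> x i \<noteq> 1 \<Longrightarrow> real (l i) < c"
  shows "real (max_exponent k x l) < c"
proof -
  have "max_exponent k x l \<in> insert 0 (l ` {i. i < k \<and> x i \<noteq> 1})"
    unfolding max_exponent_def by (rule Max_in) auto
  then show ?thesis
    using assms by auto
qed

text \<open>The constant \<open>c\<close> below covers three kinds of bounds: the terms of a progression of length at least
  5 lie between \<open>- M5\<close> and \<open>M5\<close>, which bounds its length by \<open>2 * M5 + 1\<close>; exponents of bounded terms
  with \<open>x \<noteq> 1\<close> are smaller than the absolute values of the terms; and the exponents to which no bound on the terms applies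
  are at most 6.\<close>

theorem theorem3:
  fixes \<alpha> :: nat and c\<^sub>0 :: real
  assumes "abc_conjecture" and "\<alpha> > 0" and "c\<^sub>0 > 0"
  shows "(\<exists>c\<^sub>1::real. \<forall>h \<eta> x l. represented_prog \<alpha> c\<^sub>0 h \<eta> x l \<longrightarrow>
            real (length h) < c\<^sub>1 \<and>
            (nondegenerate (length h) l \<longrightarrow>
               real (max (length h) (max_exponent (length h) x l)) < c\<^sub>1))
       \<and> finite {h. length h \<ge> 3 \<and>
            (\<exists>\<eta> x l. represented_prog \<alpha> c\<^sub>0 h \<eta> x l \<and> (\<forall>i < length h. l i \<ge> 4))}"
proof -
  have c0: "0 \<le> c\<^sub>0"
    using assms by simp
  obtain M3 :: real where M3:
    "\<And>a d \<eta> x l i. power_prog \<alpha> 3 a d \<eta> x l \<Longrightarrow>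
       (\<Sum>i<3. 1 / real (l i)) \<le> 41 / 42 \<Longrightarrow> real_of_int (gcd a d) \<le> c\<^sub>0 \<Longrightarrow> i < (3::nat) \<Longrightarrow>
       real_of_int \<bar>a + int i * d\<bar> \<le> M3"
    by (rule three_powers_bounded[OF assms(1) _ _ c0 assms(2), of "41 / 42"]) auto
  obtain M4 :: real where M4:
    "\<And>a d \<eta> x l i j. power_prog \<alpha> 4 a d \<eta> x l \<Longrightarrow>
       d \<noteq> 0 \<Longrightarrow> real_of_int (gcd a d) \<le> c\<^sub>0 \<Longrightarrow> j < (4::nat) \<Longrightarrow> 3 \<le> l j \<Longrightarrow> i < (4::nat) \<Longrightarrow>
       real_of_int \<bar>a + int i * d\<bar> \<le> M4"
    by (rule four_powers_bounded[OF assms(1) c0 assms(2)]) auto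
  obtain M5 :: real where M5:
    "\<And>a d \<eta> x l i. power_prog \<alpha> 5 a d \<eta> x l \<Longrightarrow>
       d \<noteq> 0 \<Longrightarrow> real_of_int (gcd a d) \<le> c\<^sub>0 \<Longrightarrow> i < (5::nat) \<Longrightarrow>
       real_of_int \<bar>a + int i * d\<bar> \<le> M5"
    by (rule five_powers_bounded[OF assms(1) c0 assms(2)]) auto
  define c where "c = \<bar>M3\<bar> + \<bar>M4\<bar> + 2 * \<bar>M5\<bar> + 7"
  have long_bounded: "real_of_int \<bar>h ! i\<bar> \<le> M5"
    if prog: "represented_prog \<alpha> c\<^sub>0 h \<eta> x l" and "5 \<le> length h" "i < length h" for h \<eta> x l i
  proof -
    from prog obtain a d where ad: "d \<noteq> 0" "real_of_int (gcd a d) \<le> c\<^sub>0"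
      and h: "\<forall>i < length h. h ! i = a + int i * d"
      and rep: "power_prog \<alpha> (length h) a d \<eta> x l"
      by (rule represented_progE)
    obtain a' s j where w: "a + int i * d = a' + int j * d" "j < 5" "s + 5 \<le> length h"
      "real_of_int (gcd a' d) \<le> c\<^sub>0"
      "power_prog \<alpha> 5 a' d (\<lambda>i. \<eta> (s + i)) (\<lambda>i. x (s + i)) (\<lambda>i. l (s + i))"
      by (rule window[OF rep ad(2) zero_less_numeral \<open>5 \<le> length h\<close> \<open>i < length h\<close>]) (rule that)
    have "real_of_int \<bar>a' + int j * d\<bar> \<le> M5"
      using w(5) ad(1) w(4,2) by (rule M5)
    then show ?thesis
      using h \<open>i < length h\<close> w(1) by simp
  qed
  have length_less: "real (length h) < c" if prog: "represented_prog \<alpha> c\<^sub>0 h \<eta> x l" for h \<eta> x l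
  proof (cases "5 \<le> length h")
    case True
    from prog obtain a d where d: "d \<noteq> 0" and h: "\<forall>i < length h. h ! i = a + int i * d"
      by (rule represented_progE)
    have ends: "0 < length h" "length h - 1 < length h"
      using True by linarith+
    have bounds: "real_of_int \<bar>h ! 0\<bar> \<le> M5" "real_of_int \<bar>h ! (length h - 1)\<bar> \<le> M5"
      using long_bounded[OF prog True] ends by blast+
    have "h ! (length h - 1) - h ! 0 = int (length h - 1) * d"
      using ends[THEN h[rule_format]] by simp
    moreover have "int (length h - 1) * 1 \<le> int (length h - 1) * \<bar>d\<bar>"
      using d by (intro mult_left_mono) auto
    ultimately have "int (length h - 1) \<le> \<bar>h ! (length h - 1) - h ! 0\<bar>"
      by (simp add: abs_mult)
    then have "real_of_int (int (length h - 1)) \<le> real_of_int \<bar>h ! (length h - 1) - h ! 0\<bar>"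
      by (simp only: of_int_le_iff)
    then have "real (length h) - 1 \<le> 2 * M5"
      using bounds True by (simp add: of_nat_diff)
    then show ?thesis
      by (simp add: c_def)
  qed (simp add: c_def)
  have exponent_less: "real (l i) < c"
    if prog: "represented_prog \<alpha> c\<^sub>0 h \<eta> x l" and nd: "nondegenerate (length h) l"
      and i: "i < length h" "x i \<noteq> 1" for h \<eta> x l i
  proof -
    from prog obtain a d where ad: "d \<noteq> 0" "real_of_int (gcd a d) \<le> c\<^sub>0"
      and h: "\<forall>i < length h. h ! i = a + int i * d"
      and rep: "power_prog \<alpha> (length h) a d \<eta> x l"
      by (rule represented_progE)
    have ge2: "2 \<le> l i" if "i < length h" for i
      using rep that by (simp add: power_prog_def is_rep_def)
    have less: "real (l i) < M" if "real_of_int \<bar>h ! i\<bar> \<le> M" for M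
    proof -
      have "is_rep \<alpha> (h ! i) (\<eta> i) (x i) (l i)"
        using rep h i by (simp add: power_prog_def)
      then have "int (l i) < \<bar>h ! i\<bar>"
        using i by (intro exponent_less_abs)
      then show ?thesis
        using that by linarith
    qed
    have "3 \<le> length h"
      using nd by (simp add: nondegenerate_def)
    then consider "length h = 3" | "length h = 4" | "5 \<le> length h"
      by linarith
    then show ?thesis
    proof cases
      case 1
      show ?thesis
      proof (cases "7 \<le> l i")
        case True
        have "(\<Sum>i<3. 1 / real (l i)) \<le> 41 / 42"
          using three_exponents_sum_le[of l i] nd ge2 i True 1 by simp
        have "real_of_int \<bar>a + int i * d\<bar> \<le> M3"
          using rep[unfolded 1] \<open>(\<Sum>i<3. 1 / real (l i)) \<le> 41 / 42\<close> ad(2) i(1)[unfolded 1]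
          by (rule M3)
        then have "real_of_int \<bar>h ! i\<bar> \<le> M3"
          using h i by simp
        then show ?thesis
          using less[of M3] by (simp add: c_def)
      qed (simp add: c_def)
    next
      case 2
      show ?thesis
      proof (cases "3 \<le> l i")
        case True
        have "real_of_int \<bar>a + int i * d\<bar> \<le> M4"
          using rep[unfolded 2] ad i(1)[unfolded 2] True i(1)[unfolded 2] by (rule M4)
        then have "real_of_int \<bar>h ! i\<bar> \<le> M4"
          using h i by simp
        then show ?thesis
          using less[of M4] by (simp add: c_def)
      qed (simp add: c_def)
    next
      case 3
      then show ?thesis
        using less[OF long_bounded[OF prog 3 i(1)]] by (simp add: c_def)
    qed
  qed
  have high_bounded: "real_of_int \<bar>h ! i\<bar> \<le> M3"
    if prog: "represented_prog \<alpha> c\<^sub>0 h \<eta> x l" and "3 \<le> length h" "i < length h"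
      and l: "\<forall>i < length h. 4 \<le> l i" for h \<eta> x l i
  proof -
    from prog obtain a d where ad: "d \<noteq> 0" "real_of_int (gcd a d) \<le> c\<^sub>0"
      and h: "\<forall>i < length h. h ! i = a + int i * d"
      and rep: "power_prog \<alpha> (length h) a d \<eta> x l"
      by (rule represented_progE)
    obtain a' s j where w: "a + int i * d = a' + int j * d" "j < 3" "s + 3 \<le> length h"
      "real_of_int (gcd a' d) \<le> c\<^sub>0"
      "power_prog \<alpha> 3 a' d (\<lambda>i. \<eta> (s + i)) (\<lambda>i. x (s + i)) (\<lambda>i. l (s + i))"
      by (rule window[OF rep ad(2) zero_less_numeral \<open>3 \<le> length h\<close> \<open>i < length h\<close>]) (rule that)
    have "(\<Sum>i<3. 1 / real (l (s + i))) \<le> (\<Sum>i<(3::nat). 1 / 4)"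
    proof (rule sum_mono)
      fix i :: nat assume "i \<in> {..<3}"
      then have "4 \<le> l (s + i)"
        using l w(3) by simp
      then show "1 / real (l (s + i)) \<le> 1 / 4"
        by (intro divide_left_mono) auto
    qed
    also have "\<dots> \<le> 41 / 42"
      by simp
    finally have sum: "(\<Sum>i<3. 1 / real (l (s + i))) \<le> 41 / 42" .
    have "real_of_int \<bar>a' + int j * d\<bar> \<le> M3"
      using w(5) sum w(4,2) by (rule M3)
    then show ?thesis
      using h \<open>i < length h\<close> w(1) by simp
  qed
  have "\<forall>h \<eta> x l. represented_prog \<alpha> c\<^sub>0 h \<eta> x l \<longrightarrow> real (length h) < c \<and>
      (nondegenerate (length h) l \<longrightarrow> real (max (length h) (max_exponent (length h) x l)) < c)"
  proof (intro allI impI conjI)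
    fix h \<eta> x l
    assume prog: "represented_prog \<alpha> c\<^sub>0 h \<eta> x l"
    then show "real (length h) < c"
      by (rule length_less)
    assume "nondegenerate (length h) l"
    then have "real (max_exponent (length h) x l) < c"
      using exponent_less[OF prog] by (intro max_exponent_less) (auto simp: c_def)
    then show "real (max (length h) (max_exponent (length h) x l)) < c"
      using length_less[OF prog] by (simp add: max_def)
  qed
  moreover have "finite {h. length h \<ge> 3 \<and>
      (\<exists>\<eta> x l. represented_prog \<alpha> c\<^sub>0 h \<eta> x l \<and> (\<forall>i < length h. l i \<ge> 4))}"
  proof (rule finite_subset)
    define N where "N = \<lceil>M3\<rceil>"
    show "finite {h. set h \<subseteq> {- N..N} \<and> length h \<le> nat \<lceil>c\<rceil>}"
      by (rule finite_lists_length_le) simp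
    show "{h. length h \<ge> 3 \<and> (\<exists>\<eta> x l. represented_prog \<alpha> c\<^sub>0 h \<eta> x l \<and> (\<forall>i < length h. l i \<ge> 4))}
        \<subseteq> {h. set h \<subseteq> {- N..N} \<and> length h \<le> nat \<lceil>c\<rceil>}"
    proof (safe)
      fix h \<eta> x l y
      assume *: "3 \<le> length h" "represented_prog \<alpha> c\<^sub>0 h \<eta> x l" "\<forall>i < length h. 4 \<le> l i"
      show "length h \<le> nat \<lceil>c\<rceil>"
        using length_less[OF *(2)] by linarith
      assume "y \<in> set h"
      then obtain i where "i < length h" "y = h ! i"
        by (auto simp: in_set_conv_nth)
      then have "real_of_int \<bar>y\<bar> \<le> M3"
        using high_bounded[OF *(2,1) _ *(3)] by simp
      then have "\<bar>y\<bar> \<le> N"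
        unfolding N_def by linarith
      then show "y \<in> {- N..N}"
        by auto
    qed
  qed
  ultimately show ?thesis
    by (intro conjI exI)
qed

end
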